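(* For every integer $n\ge 1$, with $a,b$ the two colors of $C_2$, $$\left|\Pi_n^{eq}\wr C_2(\{1^a1^a,1^a1^b,1^b1^a,1^b1^b\})\right|=\left|\Pi_n^{eq}\wr C_2(\{1^a2^a,1^a2^b,1^b2^a,1^b2^b\})\right|=2^n.$$
   Context: $\Pi_n\wr C_2$ is the set of colored set partitions of $[n]$ with colors $a,b$ (a set partition of $[n]$ plus a color for each element). For colors $\gamma,\delta$: a colored partition eq-contains $1^\gamma1^\delta$ if some block contains elements $x<y$ with $x$ colored $\gamma$ and $y$ colored $\delta$; it eq-contains $1^\gamma2^\delta$ if there are $x<y$ in different blocks with $x$ colored $\gamma$ and $y$ colored $\delta$. For a set $R$ of such patterns, $\Pi_n^{eq}\wr C_2(R)$ is the set of colored partitions eq-containing no pattern of $R$. *)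

theory Defs
  imports Main "HOL-Library.FuncSet" "HOL-Library.Disjoint_Sets"
begin

datatype color = Color_a | Color_b

text \<open>\<open>Pat11 \<gamma> \<delta>\<close> is the pattern \<open>1\<^sup>\<gamma>1\<^sup>\<delta>\<close> and \<open>Pat12 \<gamma> \<delta>\<close> is the pattern \<open>1\<^sup>\<gamma>2\<^sup>\<delta>\<close>.\<close>

datatype pattern = Pat11 color color | Pat12 color color

text \<open>Colorings are extensional, so that they are determined by their values on \<open>{1..n}\<close> and
  counting pairs \<open>(P, c)\<close> counts colored partitions.\<close>

definition colored_partitions :: "nat \<Rightarrow> (nat set set \<times> (nat \<Rightarrow> color)) set" where
  "colored_partitions n = {P. partition_on {1..n} P} \<times> ({1..n} \<rightarrow>\<^sub>E UNIV)"

fun eq_contains :: "nat set set \<times> (nat \<Rightarrow> color) \<Rightarrow> pattern \<Rightarrow> bool" where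
  "eq_contains (P, c) (Pat11 \<gamma> \<delta>) \<longleftrightarrow>
     (\<exists>B\<in>P. \<exists>x\<in>B. \<exists>y\<in>B. x < y \<and> c x = \<gamma> \<and> c y = \<delta>)"
| "eq_contains (P, c) (Pat12 \<gamma> \<delta>) \<longleftrightarrow>
     (\<exists>B\<in>P. \<exists>C\<in>P. B \<noteq> C \<and> (\<exists>x\<in>B. \<exists>y\<in>C. x < y \<and> c x = \<gamma> \<and> c y = \<delta>))"

definition eq_avoiders :: "nat \<Rightarrow> pattern set \<Rightarrow> (nat set set \<times> (nat \<Rightarrow> color)) set" where
  "eq_avoiders n R = {\<pi> \<in> colored_partitions n. \<forall>p\<in>R. \<not> eq_contains \<pi> p}"

end

theory Submission
  imports Defs
begin

text \<open>Forbidding a shape in all four colorings ignores the colors: avoiding every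
  \<open>1\<^sup>\<gamma>1\<^sup>\<delta>\<close> forces all blocks to be singletons, avoiding every \<open>1\<^sup>\<gamma>2\<^sup>\<delta>\<close> forces a single
  block, and in either case all \<open>2\<^sup>n\<close> colorings remain.\<close>

lemma UNIV_color: "(UNIV :: color set) = {Color_a, Color_b}"
  using color.exhaust by auto

lemma card_colorings: "card ({1..n::nat} \<rightarrow>\<^sub>E (UNIV :: color set)) = 2 ^ n"
  by (simp add: card_PiE UNIV_color numeral_2_eq_2)

text \<open>Lets the four listed patterns be read as a quantification over both colors at
  once.\<close>

lemma all_color_iff: "(\<forall>\<gamma>. Q \<gamma>) \<longleftrightarrow> Q Color_a \<and> Q Color_b"
  by (metis color.exhaust)

lemma avoids_all_Pat11_iff:
  "(\<forall>p\<in>{Pat11 Color_a Color_a, Pat11 Color_a Color_b,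
         Pat11 Color_b Color_a, Pat11 Color_b Color_b}. \<not> eq_contains (P, c) p)
   \<longleftrightarrow> (\<forall>B\<in>P. \<forall>x\<in>B. \<forall>y\<in>B. x = y)"
proof -
  have "(\<forall>p\<in>{Pat11 Color_a Color_a, Pat11 Color_a Color_b,
              Pat11 Color_b Color_a, Pat11 Color_b Color_b}. \<not> eq_contains (P, c) p)
        \<longleftrightarrow> (\<forall>\<gamma> \<delta>. \<not> eq_contains (P, c) (Pat11 \<gamma> \<delta>))"
    \<comment> \<open>\<open>eq_contains\<close> stays folded, so the two sides become the same
      conjunction of four atoms.\<close>
    unfolding all_color_iff ball_simps by (simp del: eq_contains.simps)
  \<comment> \<open>Any pair \<open>x < y\<close> in a block realizes the pattern with \<gamma> =
    \<open>c x\<close> and \<delta> = \<open>c y\<close>, so the coloring drops out.\<close>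
  also have "\<dots> \<longleftrightarrow> (\<forall>B\<in>P. \<forall>x\<in>B. \<forall>y\<in>B. \<not> x < y)"
    unfolding eq_contains.simps by blast
  \<comment> \<open>Since \<open>x\<close> and \<open>y\<close> range over the same block, swapping
    them also excludes \<open>y < x\<close>.\<close>
  also have "\<dots> \<longleftrightarrow> (\<forall>B\<in>P. \<forall>x\<in>B. \<forall>y\<in>B. x = y)"
    by (metis nat_neq_iff)
  finally show ?thesis .
qed

text \<open>The colors drop out as for \<open>Pat11\<close>; exchanging the blocks \<open>B\<close>
  and \<open>C\<close> along with \<open>x\<close> and \<open>y\<close> turns the ban on
  \<open>x < y\<close> into equality. This form is contradictory for distinct blocks once they are
  known to be nonempty and disjoint.\<close>

lemma avoids_all_Pat12_iff:
  "(\<forall>p\<in>{Pat12 Color_a Color_a, Pat12 Color_a Color_b,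
         Pat12 Color_b Color_a, Pat12 Color_b Color_b}. \<not> eq_contains (P, c) p)
   \<longleftrightarrow> (\<forall>B\<in>P. \<forall>C\<in>P. B \<noteq> C \<longrightarrow> (\<forall>x\<in>B. \<forall>y\<in>C. x = y))"
proof -
  have "(\<forall>p\<in>{Pat12 Color_a Color_a, Pat12 Color_a Color_b,
              Pat12 Color_b Color_a, Pat12 Color_b Color_b}. \<not> eq_contains (P, c) p)
        \<longleftrightarrow> (\<forall>\<gamma> \<delta>. \<not> eq_contains (P, c) (Pat12 \<gamma> \<delta>))"
    unfolding all_color_iff ball_simps by (simp del: eq_contains.simps)
  also have "\<dots> \<longleftrightarrow> (\<forall>B\<in>P. \<forall>C\<in>P. B \<noteq> C \<longrightarrow> (\<forall>x\<in>B. \<forall>y\<in>C. \<not> x < y))"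
    unfolding eq_contains.simps by blast
  also have "\<dots> \<longleftrightarrow> (\<forall>B\<in>P. \<forall>C\<in>P. B \<noteq> C \<longrightarrow> (\<forall>x\<in>B. \<forall>y\<in>C. x = y))"
    by (metis nat_neq_iff)
  finally show ?thesis .
qed

text \<open>Blocks are nonempty, so a block with at most one element is a singleton, and covering
  \<open>A\<close> forces every singleton to occur.\<close>

lemma partition_on_subsingletons_iff:
  "partition_on A P \<and> (\<forall>B\<in>P. \<forall>x\<in>B. \<forall>y\<in>B. x = y) \<longleftrightarrow> P = (\<lambda>x. {x}) ` A"
  (is "?L \<longleftrightarrow> ?R")
proof
  assume L: ?L
  then have "\<Union>P = A" "{} \<notin> P"
    by (auto simp: partition_on_def)
  have block: "B = {x}" if "B \<in> P" "x \<in> B" for B x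
    using L that by blast
  show ?R
  proof (intro equalityI subsetI)
    fix B assume "B \<in> P"
    then obtain x where "x \<in> B"
      using \<open>{} \<notin> P\<close> by (metis ex_in_conv)
    then show "B \<in> (\<lambda>x. {x}) ` A"
      using block \<open>B \<in> P\<close> \<open>\<Union>P = A\<close> by blast
  next
    fix B assume "B \<in> (\<lambda>x. {x}) ` A"
    \<comment> \<open>The block covering the element \<open>x\<close> of \<open>A\<close> can only
      be \<open>{x}\<close>.\<close>
    then show "B \<in> P"
      using block \<open>\<Union>P = A\<close> by blast
  qed
qed (auto simp: partition_on_def disjoint_def)

text \<open>Two distinct blocks would have elements that are equal by assumption and different by
  disjointness. For empty \<open>A\<close> the equivalence fails: the only partition is
  \<open>{}\<close>, not \<open>{{}}\<close>.\<close>

lemma partition_on_one_block_iff: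
  assumes "A \<noteq> {}"
  shows "partition_on A P \<and> (\<forall>B\<in>P. \<forall>C\<in>P. B \<noteq> C \<longrightarrow> (\<forall>x\<in>B. \<forall>y\<in>C. x = y)) \<longleftrightarrow> P = {A}"
  (is "?L \<longleftrightarrow> ?R")
proof
  assume L: ?L
  then have P: "\<Union>P = A" "{} \<notin> P" "disjoint P"
    by (auto simp: partition_on_def)
  have same: "B = C" if "B \<in> P" "C \<in> P" for B C
  proof (rule ccontr)
    assume "B \<noteq> C"
    have "B \<noteq> {}" "C \<noteq> {}"
      using that \<open>{} \<notin> P\<close> by auto
    then obtain x y where "x \<in> B" "y \<in> C"
      by blast
    then show False
      using L that \<open>B \<noteq> C\<close> \<open>disjoint P\<close> by (metis disjointD disjoint_iff)
  qed
  \<comment> \<open>An element of the nonempty \<open>A\<close> lies in some block.\<close>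
  obtain B where "B \<in> P"
    using P(1) assms by blast
  then have "P = {B}"
    using same by blast
  then show ?R
    using P(1) by simp
qed (use assms in \<open>auto simp: partition_on_def disjoint_def\<close>)

lemma eq_avoiders_all_Pat11:
  "eq_avoiders n {Pat11 Color_a Color_a, Pat11 Color_a Color_b,
                  Pat11 Color_b Color_a, Pat11 Color_b Color_b}
   = {(\<lambda>x. {x}) ` {1..n}} \<times> ({1..n} \<rightarrow>\<^sub>E UNIV)"
\<comment> \<open>Splitting the element into a pair \<open>(P, c)\<close> makes the characterization
  of avoidance applicable; it constrains \<open>P\<close> only, so \<open>c\<close> remains
  free.\<close>
proof (rule set_eqI, rule prod.induct)
  fix P c
  show "(P, c) \<in> eq_avoiders n {Pat11 Color_a Color_a, Pat11 Color_a Color_b,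
                  Pat11 Color_b Color_a, Pat11 Color_b Color_b}
        \<longleftrightarrow> (P, c) \<in> {(\<lambda>x. {x}) ` {1..n}} \<times> ({1..n} \<rightarrow>\<^sub>E UNIV)"
    unfolding eq_avoiders_def colored_partitions_def mem_Collect_eq avoids_all_Pat11_iff
    using partition_on_subsingletons_iff[of "{1..n}" P] by blast
qed

lemma eq_avoiders_all_Pat12:
  assumes "n \<ge> 1"
  shows "eq_avoiders n {Pat12 Color_a Color_a, Pat12 Color_a Color_b,
                        Pat12 Color_b Color_a, Pat12 Color_b Color_b}
         = {{{1..n}}} \<times> ({1..n} \<rightarrow>\<^sub>E UNIV)"
proof (rule set_eqI, rule prod.induct)
  fix P c
  have "{1..n} \<noteq> {}"
    using assms by simp
  then show "(P, c) \<in> eq_avoiders n {Pat12 Color_a Color_a, Pat12 Color_a Color_b,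
                  Pat12 Color_b Color_a, Pat12 Color_b Color_b}
        \<longleftrightarrow> (P, c) \<in> {{{1..n}}} \<times> ({1..n} \<rightarrow>\<^sub>E UNIV)"
    unfolding eq_avoiders_def colored_partitions_def mem_Collect_eq avoids_all_Pat12_iff
    using partition_on_one_block_iff[of "{1..n}" P] by blast
qed

theorem theorem3p2:
  fixes n :: nat
  assumes "n \<ge> 1"
  shows "card (eq_avoiders n {Pat11 Color_a Color_a, Pat11 Color_a Color_b,
                              Pat11 Color_b Color_a, Pat11 Color_b Color_b})
       = card (eq_avoiders n {Pat12 Color_a Color_a, Pat12 Color_a Color_b,
                              Pat12 Color_b Color_a, Pat12 Color_b Color_b})
     \<and> card (eq_avoiders n {Pat12 Color_a Color_a, Pat12 Color_a Color_b,
                              Pat12 Color_b Color_a, Pat12 Color_b Color_b}) = 2 ^ n"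
  \<comment> \<open>Each product has a one-element first factor, so both cardinalities reduce to the
    number of colorings.\<close>
  unfolding eq_avoiders_all_Pat11 eq_avoiders_all_Pat12[OF assms] card_cartesian_product
    card_colorings
  by simp

end
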